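(* Let $H$ be an $(\alpha,\beta)$-colorable hypergraph and let $q\geq \alpha+\beta+1$. Then $\Gamma_q(H)$ is connected.
   Context: For a hypergraph $H=(V,E)$: the degree of a vertex is the number of edges containing it; a $\beta$-core of $H$ is a maximal subhypergraph in which every vertex has degree at least $\beta$; for $U\subseteq V$, "$U$ has a $\beta$-core" means the subhypergraph induced by $U$ (edges contained in $U$) has a nonempty $\beta$-core. A set is independent if it contains no edge of $H$. A sequence $V_1,\dots,V_\alpha$ of (possibly empty) sets is a maximally independent sequence of length $\alpha$ if for each $j$, $V_j$ is a maximal independent set in the subhypergraph induced by $V\setminus\bigcup_{i<j}V_i$. $H$ is $(\alpha,\beta)$-colorable if there does not exist a maximally independent sequence $V_1,\dots,V_\alpha$ of length $\alpha$ such that $V\setminus\bigcup_{i\leq\alpha}V_i$ has a $\beta$-core. A proper $[q]$-coloring is a map $\sigma:V\to[q]$ with no monochromatic edge; $\Gamma_q(H)$ is the graph whose vertices are the proper $[q]$-colorings of $H$, two colorings being adjacent iff they differ on exactly one vertex. *)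

theory Defs
  imports "HOL-Library.FuncSet" "Graph_Theory.Graph_Theory"
begin

record 'a hypergraph =
  hverts :: "'a set"
  hedges :: "'a set set"

definition is_hypergraph :: "'a hypergraph \<Rightarrow> bool" where
  "is_hypergraph H \<longleftrightarrow> finite (hverts H) \<and> (\<forall>e\<in>hedges H. e \<subseteq> hverts H)"

definition subhypergraph :: "'a hypergraph \<Rightarrow> 'a hypergraph \<Rightarrow> bool" where
  "subhypergraph K H \<longleftrightarrow> is_hypergraph K \<and> hverts K \<subseteq> hverts H \<and> hedges K \<subseteq> hedges H"

definition induced :: "'a hypergraph \<Rightarrow> 'a set \<Rightarrow> 'a hypergraph" where
  "induced H U = \<lparr>hverts = U, hedges = {e \<in> hedges H. e \<subseteq> U}\<rparr>"

definition hdegree :: "'a hypergraph \<Rightarrow> 'a \<Rightarrow> nat" where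
  "hdegree H v = card {e \<in> hedges H. v \<in> e}"

definition min_degree_ge :: "nat \<Rightarrow> 'a hypergraph \<Rightarrow> bool" where
  "min_degree_ge \<beta> K \<longleftrightarrow> (\<forall>v\<in>hverts K. \<beta> \<le> hdegree K v)"

definition is_core :: "nat \<Rightarrow> 'a hypergraph \<Rightarrow> 'a hypergraph \<Rightarrow> bool" where
  "is_core \<beta> H K \<longleftrightarrow> subhypergraph K H \<and> min_degree_ge \<beta> K \<and>
     (\<forall>L. subhypergraph L H \<and> min_degree_ge \<beta> L \<and> subhypergraph K L \<longrightarrow> L = K)"

definition has_core :: "nat \<Rightarrow> 'a hypergraph \<Rightarrow> 'a set \<Rightarrow> bool" where
  "has_core \<beta> H U \<longleftrightarrow> (\<exists>K. is_core \<beta> (induced H U) K \<and> hverts K \<noteq> {})"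

definition independent_set :: "'a hypergraph \<Rightarrow> 'a set \<Rightarrow> bool" where
  "independent_set H I \<longleftrightarrow> I \<subseteq> hverts H \<and> (\<forall>e\<in>hedges H. \<not> e \<subseteq> I)"

definition maximal_independent_set :: "'a hypergraph \<Rightarrow> 'a set \<Rightarrow> bool" where
  "maximal_independent_set H I \<longleftrightarrow> independent_set H I \<and>
     (\<forall>J. independent_set H J \<and> I \<subseteq> J \<longrightarrow> J = I)"

text \<open>Sequences are indexed by \<open>1, \<dots>, \<alpha>\<close>; values of \<open>W\<close> at other indices are irrelevant.\<close>

definition max_indep_seq :: "'a hypergraph \<Rightarrow> nat \<Rightarrow> (nat \<Rightarrow> 'a set) \<Rightarrow> bool" where
  "max_indep_seq H \<alpha> W \<longleftrightarrow>
     (\<forall>j\<in>{1..\<alpha>}. maximal_independent_set (induced H (hverts H - (\<Union>i\<in>{1..<j}. W i))) (W j))"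

definition ab_colorable :: "nat \<Rightarrow> nat \<Rightarrow> 'a hypergraph \<Rightarrow> bool" where
  "ab_colorable \<alpha> \<beta> H \<longleftrightarrow>
     \<not> (\<exists>W. max_indep_seq H \<alpha> W \<and> has_core \<beta> H (hverts H - (\<Union>i\<in>{1..\<alpha>}. W i)))"

definition monochromatic :: "('a \<Rightarrow> nat) \<Rightarrow> 'a set \<Rightarrow> bool" where
  "monochromatic \<sigma> e \<longleftrightarrow> (\<exists>c. \<forall>v\<in>e. \<sigma> v = c)"

definition proper_colorings :: "nat \<Rightarrow> 'a hypergraph \<Rightarrow> ('a \<Rightarrow> nat) set" where
  "proper_colorings q H =
     {\<sigma> \<in> hverts H \<rightarrow>\<^sub>E {1..q}. \<forall>e\<in>hedges H. \<not> monochromatic \<sigma> e}"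

text \<open>The undirected graph of colorings, represented as a digraph with a symmetric arc relation.\<close>

definition coloring_graph :: "nat \<Rightarrow> 'a hypergraph \<Rightarrow> ('a \<Rightarrow> nat) pair_pre_digraph" where
  "coloring_graph q H =
     \<lparr>pverts = proper_colorings q H,
      parcs = {(\<sigma>, \<tau>). \<sigma> \<in> proper_colorings q H \<and> \<tau> \<in> proper_colorings q H \<and>
                 (\<exists>!v. v \<in> hverts H \<and> \<sigma> v \<noteq> \<tau> v)}\<rparr>"

text \<open>
  The library's \<^const>\<open>connected\<close> requires a nonempty vertex set. An edge with at most one
  vertex is monochromatic under every coloring, so a hypergraph with such an edge has no proper
  coloring at all and its coloring graph is the null graph. The conclusion therefore has to
  distinguish: \<^const>\<open>connected\<close> when every edge has at least two vertices, and for
  arbitrary hypergraphs reachability between any two colorings.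
\<close>

end

theory Submission
  imports Defs
begin

text \<open>Induction on \<open>\<alpha>\<close>. If the class of color \<open>c\<close> is a maximal independent set \<open>W\<close>, deleting it leaves an
  \<open>(\<alpha> - 1, \<beta>)\<close>-colorable hypergraph with one color less. That hypergraph is colorable with yet another
  color \<open>d\<close> omitted, so by induction \<open>d\<close> can be freed. After enlarging the \<open>c\<close>-classes of \<open>\<sigma>\<close> and
  \<open>\<tau>\<close> to maximal independent sets, \<open>d\<close> is freed in \<open>\<sigma>\<close>, the \<open>c\<close>-class \<open>W\<close> of \<open>\<tau>\<close> is
  painted \<open>d\<close>, then \<open>c\<close> is freed outside \<open>W\<close> and \<open>W\<close> is repainted \<open>c\<close>; the rest is the
  induction hypothesis for \<open>V - W\<close>. For \<open>\<alpha> = 0\<close> every nonempty set of vertices induces a vertex of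
  degree below \<open>\<beta>\<close>, and one deletes such vertices one by one.\<close>

section \<open>Colorings, recoloring steps and peeling relative to a vertex set\<close>

definition proper_on :: "'a hypergraph \<Rightarrow> 'a set \<Rightarrow> nat set \<Rightarrow> ('a \<Rightarrow> nat) \<Rightarrow> bool" where
  "proper_on H V C \<sigma> \<longleftrightarrow> \<sigma> ` V \<subseteq> C \<and> (\<forall>e\<in>hedges H. e \<subseteq> V \<longrightarrow> \<not> monochromatic \<sigma> e)"

text \<open>Colorings are total functions here, and a step inside \<open>V\<close> leaves the values outside \<open>V\<close>
  untouched; this is what allows a path of colorings of \<open>V - W\<close> to be read as one of \<open>V\<close>.\<close>

definition recolor :: "'a hypergraph \<Rightarrow> 'a set \<Rightarrow> nat set \<Rightarrow> ('a \<Rightarrow> nat) \<Rightarrow> ('a \<Rightarrow> nat) \<Rightarrow> bool" where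
  "recolor H V C \<sigma> \<tau> \<longleftrightarrow>
     proper_on H V C \<sigma> \<and> proper_on H V C \<tau> \<and> (\<exists>v\<in>V. \<exists>c. \<tau> = \<sigma>(v := c))"

text \<open>For positive \<open>\<beta>\<close> this is (\<open>\<beta>\<close> - 1)-degeneracy of
  the subhypergraph induced by \<open>V\<close>. In a finite hypergraph it is enough to test induced
  subhypergraphs, which have the largest degrees on a given vertex set.\<close>

definition degenerate :: "'a hypergraph \<Rightarrow> nat \<Rightarrow> 'a set \<Rightarrow> bool" where
  "degenerate H \<beta> V \<longleftrightarrow> (\<forall>U\<subseteq>V. U \<noteq> {} \<longrightarrow> (\<exists>v\<in>U. hdegree (induced H U) v < \<beta>))"

text \<open>Colorability in a form made for induction on \<open>\<alpha>\<close>: no sequence has to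
  be carried along, and passing to \<open>V - W\<close> is built in.\<close>

fun peelable :: "'a hypergraph \<Rightarrow> nat \<Rightarrow> nat \<Rightarrow> 'a set \<Rightarrow> bool" where
  "peelable H \<beta> 0 V \<longleftrightarrow> degenerate H \<beta> V"
| "peelable H \<beta> (Suc \<alpha>) V \<longleftrightarrow>
     (\<forall>W. maximal_independent_set (induced H V) W \<longrightarrow> peelable H \<beta> \<alpha> (V - W))"

section \<open>Independent sets and cores\<close>

lemma hverts_induced [simp]: "hverts (induced H U) = U"
  and hedges_induced [simp]: "hedges (induced H U) = {e \<in> hedges H. e \<subseteq> U}"
  by (simp_all add: induced_def)

lemma finite_hedges: "is_hypergraph H \<Longrightarrow> finite (hedges H)"
  unfolding is_hypergraph_def by (metis Pow_iff finite_Pow_iff finite_subset subsetI)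

lemma monochromatic_cong: "(\<And>v. v \<in> e \<Longrightarrow> \<sigma> v = \<tau> v) \<Longrightarrow> monochromatic \<sigma> e = monochromatic \<tau> e"
  by (auto simp: monochromatic_def)

lemma independent_set_induced_iff:
  "independent_set (induced H U) I \<longleftrightarrow> I \<subseteq> U \<and> (\<forall>e\<in>hedges H. \<not> e \<subseteq> I)"
  by (auto simp: independent_set_def)

lemma ex_maximal_independent_set:
  assumes "finite U" "independent_set (induced H U) I"
  shows "\<exists>W. maximal_independent_set (induced H U) W \<and> I \<subseteq> W"
proof -
  let ?S = "{J. independent_set (induced H U) J}"
  have "finite ?S"
    using assms(1) by (auto intro: finite_subset[of _ "Pow U"] simp: independent_set_induced_iff)
  then obtain W where "W \<in> ?S" "I \<subseteq> W" "\<forall>J\<in>?S. W \<subseteq> J \<longrightarrow> J = W"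
    using finite_has_maximal2[of ?S I] assms(2) by auto
  then show ?thesis
    by (auto simp: maximal_independent_set_def)
qed

lemma hdegree_mono:
  assumes "is_hypergraph H" "hedges K \<subseteq> hedges L" "hedges L \<subseteq> hedges H"
  shows "hdegree K v \<le> hdegree L v"
  unfolding hdegree_def
  using assms finite_hedges[OF assms(1)]
  by (intro card_mono) (auto intro: finite_subset[of _ "hedges H"])

text \<open>A vertex set maximal among those inducing minimum degree at least \<open>\<beta>\<close>
  already induces a core. A competitor \<open>L\<close> has its edges among those induced by
  \<open>hverts L\<close>, so \<open>hverts L\<close> is a candidate too and equals
  \<open>U\<close>; this also fixes the edges of \<open>L\<close>.\<close>

lemma degenerate_if_not_has_core:
  assumes H: "is_hypergraph H" and V: "V \<subseteq> hverts H" and nc: "\<not> has_core \<beta> H V"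
  shows "degenerate H \<beta> V"
proof (rule ccontr)
  let ?S = "{U. U \<subseteq> V \<and> min_degree_ge \<beta> (induced H U)}"
  assume "\<not> degenerate H \<beta> V"
  then obtain U0 where U0: "U0 \<subseteq> V" "U0 \<noteq> {}" "min_degree_ge \<beta> (induced H U0)"
    unfolding degenerate_def min_degree_ge_def by (auto simp: not_less)
  have finV: "finite V"
    using H V by (auto simp: is_hypergraph_def intro: finite_subset)
  then have "finite ?S" by (auto intro: finite_subset[of _ "Pow V"])
  then obtain U where U: "U \<in> ?S" "U0 \<subseteq> U" and max: "\<And>U'. U' \<in> ?S \<Longrightarrow> U \<subseteq> U' \<Longrightarrow> U = U'"
    using finite_has_maximal2[of ?S U0] U0 by auto
  have "is_core \<beta> (induced H V) (induced H U)"
    unfolding is_core_def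
  proof (intro conjI allI impI)
    show "subhypergraph (induced H U) (induced H V)"
      using U finV by (auto simp: subhypergraph_def is_hypergraph_def intro: finite_subset)
    show "min_degree_ge \<beta> (induced H U)" using U by simp
  next
    fix L
    assume L: "subhypergraph L (induced H V) \<and> min_degree_ge \<beta> L \<and> subhypergraph (induced H U) L"
    then have sub: "hedges L \<subseteq> hedges (induced H (hverts L))" "hverts L \<subseteq> V" "U \<subseteq> hverts L"
      "{e \<in> hedges H. e \<subseteq> U} \<subseteq> hedges L"
      by (auto simp: subhypergraph_def is_hypergraph_def)
    have "min_degree_ge \<beta> (induced H (hverts L))"
      unfolding min_degree_ge_def
    proof
      fix v assume "v \<in> hverts (induced H (hverts L))"
      then have "\<beta> \<le> hdegree L v" using L by (auto simp: min_degree_ge_def)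
      also have "\<dots> \<le> hdegree (induced H (hverts L)) v"
        using H sub(1) by (rule hdegree_mono) auto
      finally show "\<beta> \<le> hdegree (induced H (hverts L)) v" .
    qed
    then have eq: "hverts L = U" using max[of "hverts L"] sub by auto
    moreover have "hedges L = hedges (induced H U)" using sub eq by auto
    ultimately show "L = induced H U" by (intro hypergraph.equality) auto
  qed
  moreover have "hverts (induced H U) \<noteq> {}" using U U0 by auto
  ultimately show False using nc unfolding has_core_def by blast
qed

section \<open>From maximally independent sequences to peeling\<close>

lemma max_indep_seq_Suc:
  assumes "max_indep_seq H k W"
    and "maximal_independent_set (induced H (hverts H - (\<Union>i\<in>{1..k}. W i))) X"
  shows "max_indep_seq H (Suc k) (W(Suc k := X))"
  unfolding max_indep_seq_def
proof
  fix j assume j: "j \<in> {1..Suc k}"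
  \<comment> \<open>The union stops before \<open>j\<close>, which is at most \<open>Suc k\<close>,
    so the updated entry is never read.\<close>
  have "(\<Union>i\<in>{1..<j}. (W(Suc k := X)) i) = (\<Union>i\<in>{1..<j}. W i)"
    using j by (intro SUP_cong) auto
  moreover have "j = Suc k \<Longrightarrow> {1..<j} = {1..k}" by auto
  ultimately show "maximal_independent_set
      (induced H (hverts H - (\<Union>i\<in>{1..<j}. (W(Suc k := X)) i))) ((W(Suc k := X)) j)"
    using assms j by (cases "j = Suc k") (auto simp: max_indep_seq_def)
qed

text \<open>Here \<open>k\<close> sets have been chosen and \<open>n\<close> are still to come.
  Every set over which \<open>peelable\<close> quantifies prolongs the sequence by one; once
  \<open>n\<close> is 0, colorability excludes a core.\<close>

lemma ab_colorable_peelable_aux: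
  assumes "is_hypergraph H" "ab_colorable (k + n) \<beta> H" "max_indep_seq H k W"
  shows "peelable H \<beta> n (hverts H - (\<Union>i\<in>{1..k}. W i))"
  using assms(2,3)
proof (induction n arbitrary: k W)
  case 0
  then show ?case
    using degenerate_if_not_has_core[OF assms(1)] by (auto simp: ab_colorable_def)
next
  case (Suc n)
  show ?case
    unfolding peelable.simps
  proof (intro allI impI)
    fix X
    assume X: "maximal_independent_set (induced H (hverts H - (\<Union>i\<in>{1..k}. W i))) X"
    have "peelable H \<beta> n (hverts H - (\<Union>i\<in>{1..Suc k}. (W(Suc k := X)) i))"
      using Suc.prems by (intro Suc.IH max_indep_seq_Suc X) auto
    moreover have "hverts H - (\<Union>i\<in>{1..Suc k}. (W(Suc k := X)) i) =
        hverts H - (\<Union>i\<in>{1..k}. W i) - X"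
      by (auto simp: atLeastAtMostSuc_conv)
    ultimately show "peelable H \<beta> n (hverts H - (\<Union>i\<in>{1..k}. W i) - X)"
      by (simp only:)
  qed
qed

lemma ab_colorable_peelable:
  assumes "is_hypergraph H" "ab_colorable \<alpha> \<beta> H"
  shows "peelable H \<beta> \<alpha> (hverts H)"
  using ab_colorable_peelable_aux[of H 0 \<alpha> \<beta> "\<lambda>_. {}"] assms
  by (auto simp: max_indep_seq_def)

section \<open>Recoloring paths and color classes\<close>

lemma recolor_sym: "recolor H V C \<sigma> \<tau> \<Longrightarrow> recolor H V C \<tau> \<sigma>"
proof -
  assume *: "recolor H V C \<sigma> \<tau>"
  then obtain v c where "v \<in> V" "\<tau> = \<sigma>(v := c)" by (auto simp: recolor_def)
  then have "\<exists>v\<in>V. \<exists>c. \<sigma> = \<tau>(v := c)" by (intro bexI[of _ v] exI[of _ "\<sigma> v"]) simp_all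
  with * show ?thesis by (simp add: recolor_def)
qed

lemma recolor_rtranclp_sym: "(recolor H V C)\<^sup>*\<^sup>* \<sigma> \<tau> \<Longrightarrow> (recolor H V C)\<^sup>*\<^sup>* \<tau> \<sigma>"
  by (induction rule: rtranclp_induct) (auto intro: converse_rtranclp_into_rtranclp recolor_sym)

lemma recolor_rtranclp_proper:
  "(recolor H V C)\<^sup>*\<^sup>* \<sigma> \<tau> \<Longrightarrow> proper_on H V C \<sigma> \<Longrightarrow> proper_on H V C \<tau>"
  by (induction rule: rtranclp_induct) (auto simp: recolor_def)

lemma recolor_rtranclp_outside:
  "(recolor H V C)\<^sup>*\<^sup>* \<sigma> \<tau> \<Longrightarrow> v \<notin> V \<Longrightarrow> \<tau> v = \<sigma> v"
  by (induction rule: rtranclp_induct) (auto simp: recolor_def)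

lemma proper_on_cong:
  assumes "\<And>v. v \<in> V \<Longrightarrow> \<sigma> v = \<tau> v"
  shows "proper_on H V C \<sigma> = proper_on H V C \<tau>"
proof -
  have "monochromatic \<sigma> e = monochromatic \<tau> e" if "e \<subseteq> V" for e
    using that assms by (intro monochromatic_cong) auto
  then show ?thesis
    using assms by (auto simp: proper_on_def image_subset_iff)
qed

text \<open>An edge that meets \<open>W\<close> is not contained in \<open>W\<close> by
  independence, so it shows both \<open>c\<close> and another color; the remaining edges lie in
  \<open>V - W\<close>.\<close>

lemma proper_on_extend_class:
  assumes "proper_on H (V - W) (C - {c}) \<sigma>" "\<And>w. w \<in> W \<Longrightarrow> \<sigma> w = c" "c \<in> C"
    and W: "independent_set (induced H V) W"
  shows "proper_on H V C \<sigma>"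
  unfolding proper_on_def
proof (intro conjI ballI impI)
  show "\<sigma> ` V \<subseteq> C" using assms(1-3) by (auto simp: proper_on_def)
next
  fix e assume e: "e \<in> hedges H" "e \<subseteq> V"
  show "\<not> monochromatic \<sigma> e"
  proof (cases "e \<inter> W = {}")
    case True
    then have "e \<subseteq> V - W" using e by auto
    then show ?thesis using e assms(1) by (auto simp: proper_on_def)
  next
    case False
    then obtain w where w: "w \<in> e" "w \<in> W" by auto
    obtain u where u: "u \<in> e" "u \<notin> W"
      using W e unfolding independent_set_induced_iff by blast
    then have "\<sigma> u \<noteq> c" using assms(1) e by (auto simp: proper_on_def)
    then show ?thesis using w u assms(2) by (metis monochromatic_def)
  qed
qed

text \<open>Serves to use the induction hypothesis for \<open>V - W\<close> inside \<open>V\<close>: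
  the vertices of \<open>W\<close> keep color \<open>c\<close> along the whole path.\<close>

lemma recolor_extend_class:
  assumes "(recolor H (V - W) (C - {c}))\<^sup>*\<^sup>* \<sigma> \<tau>" "\<And>w. w \<in> W \<Longrightarrow> \<sigma> w = c" "c \<in> C"
    and W: "independent_set (induced H V) W"
  shows "(recolor H V C)\<^sup>*\<^sup>* \<sigma> \<tau>"
  using assms(1)
proof (induction rule: rtranclp_induct)
  case (step \<rho> \<tau>)
  have "(recolor H (V - W) (C - {c}))\<^sup>*\<^sup>* \<sigma> \<tau>" using step.hyps by simp
  then have "\<rho> w = c" "\<tau> w = c" if "w \<in> W" for w
    using that recolor_rtranclp_outside[of H "V - W"] step.hyps(1) assms(2) by (metis DiffD2)+
  then have "recolor H V C \<rho> \<tau>"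
    using step.hyps(2) proper_on_extend_class[OF _ _ assms(3) W] unfolding recolor_def by blast
  with step.IH show ?case by simp
qed simp

lemma proper_on_remove_class:
  assumes "proper_on H V C \<sigma>" "{v \<in> V. \<sigma> v = c} \<subseteq> W"
  shows "proper_on H (V - W) (C - {c}) \<sigma>"
  using assms by (auto simp: proper_on_def)

text \<open>The vertices of \<open>W\<close> are painted one at a time. Every edge in
  \<open>V\<close> has a vertex \<open>u\<close> outside \<open>W\<close>, whose color is not
  \<open>c\<close>; an edge monochromatic at an intermediate stage would carry the color of
  \<open>u\<close>, avoid all painted vertices, and be monochromatic under
  \<open>\<sigma>\<close>.\<close>

lemma recolor_independent:
  assumes "proper_on H V C \<sigma>" "finite V" "independent_set (induced H V) W"
    and "{v \<in> V. \<sigma> v = c} \<subseteq> W" "c \<in> C"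
  shows "(recolor H V C)\<^sup>*\<^sup>* \<sigma> (override_on \<sigma> (\<lambda>_. c) W)"
proof -
  have proper: "proper_on H V C (override_on \<sigma> (\<lambda>_. c) X)" if X: "X \<subseteq> W" for X
    unfolding proper_on_def
  proof (intro conjI ballI impI notI)
    show "override_on \<sigma> (\<lambda>_. c) X ` V \<subseteq> C"
      using assms(1,5) by (auto simp: proper_on_def override_on_def)
  next
    fix e assume e: "e \<in> hedges H" "e \<subseteq> V" and mono: "monochromatic (override_on \<sigma> (\<lambda>_. c) X) e"
    obtain u where u: "u \<in> e" "u \<notin> W"
      using assms(3) e unfolding independent_set_induced_iff by blast
    then have ne: "\<sigma> u \<noteq> c" using assms(4) e by auto
    have eq: "override_on \<sigma> (\<lambda>_. c) X v = \<sigma> u" if "v \<in> e" for v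
      using mono that u X unfolding monochromatic_def by (metis override_on_apply_notin subsetD)
    then have "v \<notin> X" if "v \<in> e" for v
      using that ne by (metis override_on_apply_in)
    then have "monochromatic \<sigma> e"
      unfolding monochromatic_def using eq by (metis override_on_apply_notin)
    then show False using assms(1) e by (auto simp: proper_on_def)
  qed
  have WV: "W \<subseteq> V" using assms(3) by (auto simp: independent_set_induced_iff)
  then have finW: "finite W" using assms(2) by (rule finite_subset)
  have "(recolor H V C)\<^sup>*\<^sup>* \<sigma> (override_on \<sigma> (\<lambda>_. c) X)" if "X \<subseteq> W" for X
    using finite_subset[OF that finW] that
  proof (induction X rule: finite_induct)
    case (insert x X)
    have "override_on \<sigma> (\<lambda>_. c) (insert x X) = (override_on \<sigma> (\<lambda>_. c) X)(x := c)"
      by (auto simp: override_on_def)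
    then have "recolor H V C (override_on \<sigma> (\<lambda>_. c) X) (override_on \<sigma> (\<lambda>_. c) (insert x X))"
      unfolding recolor_def using proper[of X] proper[of "insert x X"] insert.prems WV by auto
    then show ?case using insert by (auto intro: rtranclp.rtrancl_into_rtrancl)
  qed simp
  then show ?thesis by blast
qed

lemma recolor_to_maximal_class:
  assumes "proper_on H V C \<sigma>" "finite V" "c \<in> C"
  shows "\<exists>\<rho>. (recolor H V C)\<^sup>*\<^sup>* \<sigma> \<rho> \<and> maximal_independent_set (induced H V) {v \<in> V. \<rho> v = c}"
proof -
  have "independent_set (induced H V) {v \<in> V. \<sigma> v = c}"
    unfolding independent_set_induced_iff
  proof (intro conjI ballI notI)
    fix e assume e: "e \<in> hedges H" "e \<subseteq> {v \<in> V. \<sigma> v = c}"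
    then have "monochromatic \<sigma> e" "e \<subseteq> V" unfolding monochromatic_def by blast+
    then show False using assms(1) e(1) by (simp add: proper_on_def)
  qed blast
  then obtain W where W: "maximal_independent_set (induced H V) W" "{v \<in> V. \<sigma> v = c} \<subseteq> W"
    using ex_maximal_independent_set[OF assms(2)] by blast
  then have ind: "independent_set (induced H V) W" by (simp add: maximal_independent_set_def)
  \<comment> \<open>The old \<open>c\<close>-class lies inside \<open>W\<close>, so the new one is
    exactly \<open>W\<close>.\<close>
  then have "W = {v \<in> V. override_on \<sigma> (\<lambda>_. c) W v = c}"
    using W(2) by (auto simp: independent_set_induced_iff override_on_def)
  then have "maximal_independent_set (induced H V) {v \<in> V. override_on \<sigma> (\<lambda>_. c) W v = c}"
    using W(1) by simp
  with recolor_independent[OF assms(1,2) ind W(2) assms(3)] show ?thesis by blast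
qed

section \<open>Greedy coloring and the degenerate case\<close>

text \<open>Each edge at \<open>v\<close> forbids at most one color: it suffices to avoid the color
  of one chosen vertex of the edge other than \<open>v\<close>, which exists by the second
  assumption.\<close>

lemma obtain_free_color:
  assumes "is_hypergraph H" "\<forall>e\<in>hedges H. \<forall>v. \<not> e \<subseteq> {v}"
    and "hdegree (induced H V) v < card C"
  obtains d where "d \<in> C"
    and "\<forall>e\<in>hedges H. e \<subseteq> V \<longrightarrow> v \<in> e \<longrightarrow> (\<exists>w\<in>e - {v}. \<sigma> w \<noteq> d)"
proof -
  let ?E = "{e \<in> hedges (induced H V). v \<in> e}"
  let ?B = "(\<lambda>e. \<sigma> (SOME w. w \<in> e - {v})) ` ?E"
  have "finite ?E" using finite_hedges[OF assms(1)] by simp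
  then have "finite ?B" and "card ?B \<le> card ?E"
    by (rule finite_imageI, rule card_image_le)
  moreover have "card ?E < card C" using assms(3) by (simp only: hdegree_def)
  ultimately have "\<not> C \<subseteq> ?B" using card_mono[of ?B C] by linarith
  then obtain d where d: "d \<in> C" "d \<notin> ?B" by blast
  have "\<exists>w\<in>e - {v}. \<sigma> w \<noteq> d" if e: "e \<in> hedges H" "e \<subseteq> V" "v \<in> e" for e
  proof -
    have "\<exists>w. w \<in> e - {v}" using e assms(2) by blast
    then have "(SOME w. w \<in> e - {v}) \<in> e - {v}" by (rule someI_ex)
    moreover have "\<sigma> (SOME w. w \<in> e - {v}) \<noteq> d" using d e by auto
    ultimately show ?thesis by blast
  qed
  with d that show thesis by blast
qed

lemma proper_on_insert_vertex:
  assumes "proper_on H (V - {v}) C \<sigma>" "d \<in> C" "v \<in> V"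
    and "\<forall>e\<in>hedges H. e \<subseteq> V \<longrightarrow> v \<in> e \<longrightarrow> (\<exists>w\<in>e - {v}. \<sigma> w \<noteq> d)"
  shows "proper_on H V C (\<sigma>(v := d))"
  unfolding proper_on_def
proof (intro conjI ballI impI)
  show "(\<sigma>(v := d)) ` V \<subseteq> C" using assms(1,2) by (auto simp: proper_on_def)
next
  fix e assume e: "e \<in> hedges H" "e \<subseteq> V"
  show "\<not> monochromatic (\<sigma>(v := d)) e"
  proof (cases "v \<in> e")
    case True
    then obtain w where "w \<in> e" "w \<noteq> v" "\<sigma> w \<noteq> d" using assms(4) e by blast
    then show ?thesis using True unfolding monochromatic_def by (metis fun_upd_other fun_upd_same)
  next
    case False
    then have "monochromatic (\<sigma>(v := d)) e = monochromatic \<sigma> e"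
      by (intro monochromatic_cong) auto
    then show ?thesis using assms(1) e False by (auto simp: proper_on_def)
  qed
qed

lemma proper_on_subset: "proper_on H V C \<sigma> \<Longrightarrow> U \<subseteq> V \<Longrightarrow> proper_on H U C \<sigma>"
  by (auto simp: proper_on_def)

lemma degenerate_subset: "degenerate H \<beta> V \<Longrightarrow> U \<subseteq> V \<Longrightarrow> degenerate H \<beta> U"
  by (auto simp: degenerate_def)

lemma degenerate_ex_proper:
  assumes "is_hypergraph H" "\<forall>e\<in>hedges H. \<forall>v. \<not> e \<subseteq> {v}" "\<beta> \<le> card C"
    and "finite V" "degenerate H \<beta> V"
  shows "\<exists>\<sigma>. proper_on H V C \<sigma>"
  using assms(4,5)
proof (induction V rule: finite_remove_induct)
  case empty
  \<comment> \<open>An empty edge would lie even in the empty vertex set; \<open>assms(2)\<close>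
    excludes it.\<close>
  then show ?case using assms(2) by (auto simp: proper_on_def)
next
  case (remove V)
  then obtain v where v: "v \<in> V" "hdegree (induced H V) v < card C"
    using assms(3) unfolding degenerate_def by (meson order_refl order_less_le_trans)
  obtain \<sigma> where \<sigma>: "proper_on H (V - {v}) C \<sigma>"
    using remove.IH[OF v(1)] degenerate_subset[OF remove.prems] by blast
  obtain d where "d \<in> C" "\<forall>e\<in>hedges H. e \<subseteq> V \<longrightarrow> v \<in> e \<longrightarrow> (\<exists>w\<in>e - {v}. \<sigma> w \<noteq> d)"
    by (rule obtain_free_color[OF assms(1,2) v(2), of \<sigma>])
  then show ?case using proper_on_insert_vertex[OF \<sigma> _ v(1)] by blast
qed

text \<open>One color is spent on each of the \<open>\<alpha>\<close> removed sets and
  \<open>\<beta>\<close> colors on the degenerate rest. This count is what later allows a color to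
  be omitted.\<close>

lemma peelable_ex_proper:
  assumes "is_hypergraph H" "\<forall>e\<in>hedges H. \<forall>v. \<not> e \<subseteq> {v}"
    and "\<alpha> + \<beta> \<le> card C" "finite C" "finite V" "peelable H \<beta> \<alpha> V"
  shows "\<exists>\<sigma>. proper_on H V C \<sigma>"
  using assms(3-6)
proof (induction \<alpha> arbitrary: C V)
  case 0
  then show ?case using degenerate_ex_proper[OF assms(1,2)] by simp
next
  case (Suc \<alpha>)
  have "independent_set (induced H V) {}"
    using assms(2) by (auto simp: independent_set_induced_iff)
  then obtain W where W: "maximal_independent_set (induced H V) W"
    using ex_maximal_independent_set Suc.prems(3) by blast
  then have ind: "independent_set (induced H V) W" by (simp add: maximal_independent_set_def)
  obtain c where c: "c \<in> C" using Suc.prems(1) by fastforce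
  have "\<exists>\<sigma>. proper_on H (V - W) (C - {c}) \<sigma>"
    using Suc.prems W c by (intro Suc.IH) (auto simp: card_Diff_singleton)
  then obtain \<sigma> where \<sigma>: "proper_on H (V - W) (C - {c}) \<sigma>" by blast
  have "proper_on H (V - W) (C - {c}) (override_on \<sigma> (\<lambda>_. c) W)"
    using \<sigma> by (subst proper_on_cong[of _ _ \<sigma>]) auto
  then have "proper_on H V C (override_on \<sigma> (\<lambda>_. c) W)"
    using proper_on_extend_class[OF _ _ c ind] by simp
  then show ?case by blast
qed

text \<open>Only the color of \<open>v\<close> can obstruct a step of the path, so \<open>v\<close>
  is moved out of the way before each step. Its final color \<open>b\<close> is not controlled;
  \<open>degenerate_connected\<close> corrects it by one last step.\<close>

lemma recolor_lift_vertex: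
  assumes "is_hypergraph H" "\<forall>e\<in>hedges H. \<forall>v. \<not> e \<subseteq> {v}" "finite C"
    and v: "v \<in> V" and deg: "hdegree (induced H V) v + 1 < card C"
    and path: "(recolor H (V - {v}) C)\<^sup>*\<^sup>* \<sigma> \<tau>" and \<sigma>: "proper_on H V C \<sigma>"
  shows "\<exists>b. (recolor H V C)\<^sup>*\<^sup>* \<sigma> (\<tau>(v := b))"
  using path
proof (induction rule: rtranclp_induct)
  case base
  then show ?case by (metis fun_upd_triv rtranclp.rtrancl_refl)
next
  case (step \<rho> \<tau>)
  then obtain a where a: "(recolor H V C)\<^sup>*\<^sup>* \<sigma> (\<rho>(v := a))" by blast
  from step.hyps(2) obtain u c where u: "u \<in> V" "u \<noteq> v" "\<tau> = \<rho>(u := c)"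
    and \<rho>: "proper_on H (V - {v}) C \<rho>" and \<tau>: "proper_on H (V - {v}) C \<tau>"
    by (auto simp: recolor_def)
  have "c \<in> C" using \<tau> u by (auto simp: proper_on_def)
  then have "hdegree (induced H V) v < card (C - {c})"
    using deg assms(3) by (simp add: card_Diff_singleton)
  text \<open>Giving \<open>v\<close> a color that is free in \<open>\<rho>\<close> and different from the next color \<open>c\<close>
    costs one color more than greedy coloring and keeps \<open>u\<close> free to move.\<close>
  then obtain d where d: "d \<in> C - {c}"
    "\<forall>e\<in>hedges H. e \<subseteq> V \<longrightarrow> v \<in> e \<longrightarrow> (\<exists>w\<in>e - {v}. \<rho> w \<noteq> d)"
    by (rule obtain_free_color[OF assms(1,2), of _ _ _ \<rho>])
  have pd: "proper_on H V C (\<rho>(v := d))"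
    using proper_on_insert_vertex[OF \<rho> _ v] d by auto
  \<comment> \<open>\<open>d\<close> stays free after the step: only \<open>u\<close> has changed,
    and its new color \<open>c\<close> differs from \<open>d\<close>.\<close>
  have d': "\<forall>e\<in>hedges H. e \<subseteq> V \<longrightarrow> v \<in> e \<longrightarrow> (\<exists>w\<in>e - {v}. \<tau> w \<noteq> d)"
    using d u(3) by (metis Diff_iff fun_upd_apply insertCI)
  have pd': "proper_on H V C (\<tau>(v := d))"
    using proper_on_insert_vertex[OF \<tau> _ v d'] d(1) by auto
  have "recolor H V C (\<rho>(v := a)) (\<rho>(v := d))"
    using recolor_rtranclp_proper[OF a \<sigma>] pd v unfolding recolor_def
    by (metis fun_upd_upd)
  moreover have "recolor H V C (\<rho>(v := d)) (\<tau>(v := d))"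
    using pd pd' u unfolding recolor_def by (metis fun_upd_twist)
  ultimately show ?case using a by (meson rtranclp.rtrancl_into_rtrancl)
qed

lemma degenerate_connected:
  assumes "is_hypergraph H" "\<forall>e\<in>hedges H. \<forall>v. \<not> e \<subseteq> {v}" "\<beta> + 1 \<le> card C" "finite C"
    and "finite V" "degenerate H \<beta> V"
    and "proper_on H V C \<sigma>" "proper_on H V C \<tau>" "\<And>v. v \<notin> V \<Longrightarrow> \<sigma> v = \<tau> v"
  shows "(recolor H V C)\<^sup>*\<^sup>* \<sigma> \<tau>"
  using assms(5-9)
proof (induction V arbitrary: \<sigma> \<tau> rule: finite_remove_induct)
  case empty
  then have "\<sigma> = \<tau>" by auto
  then show ?case by simp
next
  case (remove V)
  then obtain v where v: "v \<in> V" "hdegree (induced H V) v < \<beta>"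
    unfolding degenerate_def by (meson order_refl)
  \<comment> \<open>The target is altered at \<open>v\<close> to agree with \<open>\<sigma>\<close>
    outside \<open>V - {v}\<close>, as the induction hypothesis demands.\<close>
  define \<tau>' where "\<tau>' = \<tau>(v := \<sigma> v)"
  have "proper_on H (V - {v}) C \<sigma>" "proper_on H (V - {v}) C \<tau>"
    using remove.prems(2,3) proper_on_subset by blast+
  moreover have "proper_on H (V - {v}) C \<tau>' = proper_on H (V - {v}) C \<tau>"
    unfolding \<tau>'_def by (rule proper_on_cong) auto
  moreover have "\<sigma> u = \<tau>' u" if "u \<notin> V - {v}" for u
    using remove.prems(4) that by (auto simp: \<tau>'_def)
  ultimately have "(recolor H (V - {v}) C)\<^sup>*\<^sup>* \<sigma> \<tau>'"
    using remove.IH[OF v(1) degenerate_subset[OF remove.prems(1)]] by blast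
  \<comment> \<open>The degree of \<open>v\<close> plus 1 is at most \<open>\<beta>\<close>, hence
    below \<open>card C\<close>: here the extra color is spent.\<close>
  then obtain b where b: "(recolor H V C)\<^sup>*\<^sup>* \<sigma> (\<tau>'(v := b))"
    using recolor_lift_vertex[OF assms(1,2,4) v(1)] v(2) assms(3) remove.prems(2) by force
  have "\<tau> = \<tau>'(v := b, v := \<tau> v)" by (simp add: \<tau>'_def)
  then have "recolor H V C (\<tau>'(v := b)) \<tau>"
    using recolor_rtranclp_proper[OF b remove.prems(2)] remove.prems(3) v(1)
    unfolding recolor_def by blast
  with b show ?case by simp
qed

section \<open>Exchanging color classes and the induction on \<open>\<alpha>\<close>\<close>

text \<open>The hypothesis \<open>conn\<close> is the induction hypothesis of the main argument for \<open>V - W\<close>.\<close>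

lemma recolor_free_color:
  assumes "is_hypergraph H" "\<forall>e\<in>hedges H. \<forall>v. \<not> e \<subseteq> {v}"
    and "Suc \<alpha> + \<beta> + 1 \<le> card C" "finite C" "finite V"
    and W: "independent_set (induced H V) W" and peel: "peelable H \<beta> \<alpha> (V - W)"
    and \<sigma>: "proper_on H V C \<sigma>" "{v \<in> V. \<sigma> v = c} = W" and "c \<in> C" "d \<in> C" "c \<noteq> d"
    and conn: "\<And>\<rho>. proper_on H (V - W) (C - {c}) \<rho> \<Longrightarrow> (\<And>v. v \<notin> V - W \<Longrightarrow> \<sigma> v = \<rho> v) \<Longrightarrow>
      (recolor H (V - W) (C - {c}))\<^sup>*\<^sup>* \<sigma> \<rho>"
  shows "\<exists>\<rho>. (recolor H V C)\<^sup>*\<^sup>* \<sigma> \<rho> \<and> {v \<in> V. \<rho> v = d} = {}"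
proof -
  \<comment> \<open>Without \<open>c\<close> and \<open>d\<close> at least
    \<open>\<alpha> + \<beta>\<close> colors remain, the number that
    \<open>peelable_ex_proper\<close> asks for.\<close>
  have "\<exists>\<rho>. proper_on H (V - W) (C - {c} - {d}) \<rho>"
    using assms(3-5,10-12) peel
    by (intro peelable_ex_proper[OF assms(1,2)]) (auto simp: card_Diff_singleton)
  then obtain \<rho>0 where \<rho>0: "proper_on H (V - W) (C - {c} - {d}) \<rho>0" by blast
  \<comment> \<open>Outside \<open>V - W\<close> the values of \<open>\<sigma>\<close> are kept, as
    \<open>conn\<close> requires. So \<open>W\<close> keeps color \<open>c\<close>, and
    \<open>d\<close> is absent from all of \<open>V\<close>.\<close>
  define \<rho> where "\<rho> = override_on \<sigma> \<rho>0 (V - W)"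
  have \<rho>: "proper_on H (V - W) (C - {c} - {d}) \<rho>"
    using \<rho>0 by (subst proper_on_cong[of _ _ \<rho>0]) (auto simp: \<rho>_def)
  then have "proper_on H (V - W) (C - {c}) \<rho>" by (auto simp: proper_on_def)
  then have "(recolor H (V - W) (C - {c}))\<^sup>*\<^sup>* \<sigma> \<rho>"
    by (rule conn) (auto simp: \<rho>_def override_on_def)
  then have "(recolor H V C)\<^sup>*\<^sup>* \<sigma> \<rho>"
    using recolor_extend_class[OF _ _ assms(10) W] \<sigma>(2) by blast
  moreover have "\<rho> v \<noteq> d" if "v \<in> V" for v
  proof (cases "v \<in> W")
    case True
    then show ?thesis using \<sigma>(2) assms(12) by (auto simp: \<rho>_def override_on_def)
  next
    case False
    then show ?thesis using \<rho> that by (auto simp: proper_on_def)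
  qed
  ultimately show ?thesis by blast
qed

text \<open>The colors form an arbitrary finite set \<open>C\<close> because the induction deletes a
  color, sometimes \<open>c\<close> and sometimes \<open>d\<close>. Agreement outside
  \<open>V\<close> is forced, since recoloring steps never act there.\<close>

lemma peelable_connected:
  assumes "is_hypergraph H" "\<forall>e\<in>hedges H. \<forall>v. \<not> e \<subseteq> {v}"
    and "\<alpha> + \<beta> + 1 \<le> card C" "finite C" "finite V" "peelable H \<beta> \<alpha> V"
    and "proper_on H V C \<sigma>" "proper_on H V C \<tau>" "\<And>v. v \<notin> V \<Longrightarrow> \<sigma> v = \<tau> v"
  shows "(recolor H V C)\<^sup>*\<^sup>* \<sigma> \<tau>"
  using assms(3-9)
proof (induction \<alpha> arbitrary: C V \<sigma> \<tau>)
  case 0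
  then show ?case
    by (intro degenerate_connected[OF assms(1,2), of \<beta>]) auto
next
  case (Suc \<alpha>)
  note finC = \<open>finite C\<close> and finV = \<open>finite V\<close>
  have "2 \<le> card C" using Suc.prems(1) by simp
  then obtain c d where cd: "c \<in> C" "d \<in> C" "c \<noteq> d"
    by (metis card_le_Suc0_iff_eq finC not_less_eq_eq numeral_2_eq_2)
  let ?M = "maximal_independent_set (induced H V)"
  have ind: "independent_set (induced H V) X" if "?M X" for X
    using that by (simp add: maximal_independent_set_def)
  have peel: "peelable H \<beta> \<alpha> (V - X)" if "?M X" for X
    using that Suc.prems(4) by simp
  \<comment> \<open>Left general in \<open>X\<close> and \<open>a\<close>: it serves the
    \<open>c\<close>-class of \<open>\<sigma>1\<close>, then \<open>W\<close> with color
    \<open>d\<close>, and finally \<open>W\<close> with color \<open>c\<close>.\<close>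
  have IH: "(recolor H (V - X) (C - {a}))\<^sup>*\<^sup>* \<rho> \<rho>'"
    if "?M X" "a \<in> C" "proper_on H (V - X) (C - {a}) \<rho>" "proper_on H (V - X) (C - {a}) \<rho>'"
      "\<And>v. v \<notin> V - X \<Longrightarrow> \<rho> v = \<rho>' v" for X a \<rho> \<rho>'
    using Suc.prems(1) finC finV that peel[OF that(1)]
    by (intro Suc.IH) (auto simp: card_Diff_singleton)
  have free: "\<exists>\<rho>'. (recolor H V C)\<^sup>*\<^sup>* \<rho> \<rho>' \<and> {v \<in> V. \<rho>' v = b} = {}"
    if "?M X" "proper_on H V C \<rho>" "{v \<in> V. \<rho> v = a} = X" "a \<in> C" "b \<in> C" "a \<noteq> b" for X a b \<rho>
    using recolor_free_color[OF assms(1,2) Suc.prems(1) finC finV ind[OF that(1)] peel[OF that(1)]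
        that(2-6)] IH[OF that(1,4)] proper_on_remove_class[OF that(2), of a X] that(3)
    by blast

  obtain \<sigma>1 where \<sigma>1: "(recolor H V C)\<^sup>*\<^sup>* \<sigma> \<sigma>1" "?M {v \<in> V. \<sigma>1 v = c}"
    using recolor_to_maximal_class[OF Suc.prems(5) finV cd(1)] by blast
  obtain \<tau>1 where \<tau>1: "(recolor H V C)\<^sup>*\<^sup>* \<tau> \<tau>1" "?M {v \<in> V. \<tau>1 v = c}"
    using recolor_to_maximal_class[OF Suc.prems(6) finV cd(1)] by blast
  define W where "W = {v \<in> V. \<tau>1 v = c}"
  have W: "?M W" using \<tau>1 by (simp add: W_def)
  have p\<tau>1: "proper_on H V C \<tau>1" using recolor_rtranclp_proper[OF \<tau>1(1)] Suc.prems(6) .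

  text \<open>The class \<open>W\<close> of the target is parked in color \<open>d\<close> until color \<open>c\<close> has become free for it.\<close>

  obtain \<sigma>2 where \<sigma>2: "(recolor H V C)\<^sup>*\<^sup>* \<sigma> \<sigma>2" "{v \<in> V. \<sigma>2 v = d} = {}"
    using free[OF \<sigma>1(2) _ refl cd] recolor_rtranclp_proper[OF \<sigma>1(1) Suc.prems(5)] \<sigma>1(1)
    by (meson rtranclp_trans)
  define \<sigma>3 where "\<sigma>3 = override_on \<sigma>2 (\<lambda>_. d) W"
  have "(recolor H V C)\<^sup>*\<^sup>* \<sigma>2 \<sigma>3"
    using recolor_independent[OF recolor_rtranclp_proper[OF \<sigma>2(1) Suc.prems(5)] finV ind[OF W] _ cd(2)]
      \<sigma>2(2) by (simp add: \<sigma>3_def)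
  with \<sigma>2(1) have \<sigma>3: "(recolor H V C)\<^sup>*\<^sup>* \<sigma> \<sigma>3" by simp
  \<comment> \<open>Now \<open>W\<close> is the entire \<open>d\<close>-class and maximal
    independent, so \<open>free\<close> applies with \<open>c\<close> and \<open>d\<close>
    exchanged.\<close>
  have "{v \<in> V. \<sigma>3 v = d} = W" using \<sigma>2(2) by (auto simp: \<sigma>3_def override_on_def W_def)
  then obtain \<sigma>4 where \<sigma>4: "(recolor H V C)\<^sup>*\<^sup>* \<sigma> \<sigma>4" "{v \<in> V. \<sigma>4 v = c} = {}"
    using free[OF W _ _ cd(2,1)] recolor_rtranclp_proper[OF \<sigma>3 Suc.prems(5)] \<sigma>3 cd(3)
    by (metis rtranclp_trans)
  define \<sigma>5 where "\<sigma>5 = override_on \<sigma>4 (\<lambda>_. c) W"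
  have "(recolor H V C)\<^sup>*\<^sup>* \<sigma>4 \<sigma>5"
    using recolor_independent[OF recolor_rtranclp_proper[OF \<sigma>4(1) Suc.prems(5)] finV ind[OF W] _ cd(1)]
      \<sigma>4(2) by (simp add: \<sigma>5_def)
  with \<sigma>4(1) have \<sigma>5: "(recolor H V C)\<^sup>*\<^sup>* \<sigma> \<sigma>5" by simp
  have cls5: "{v \<in> V. \<sigma>5 v = c} = W" using \<sigma>4(2) by (auto simp: \<sigma>5_def override_on_def W_def)

  \<comment> \<open>Both colorings have \<open>W\<close> as their \<open>c\<close>-class, so they
    agree on \<open>W\<close>; outside \<open>V\<close> they still agree as \<open>\<sigma>\<close>
    and \<open>\<tau>\<close> do.\<close>
  have "(recolor H (V - W) (C - {c}))\<^sup>*\<^sup>* \<sigma>5 \<tau>1"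
  proof (rule IH[OF W cd(1)])
    show "proper_on H (V - W) (C - {c}) \<sigma>5"
      using proper_on_remove_class recolor_rtranclp_proper[OF \<sigma>5 Suc.prems(5)] cls5 by blast
    show "proper_on H (V - W) (C - {c}) \<tau>1"
      using proper_on_remove_class[OF p\<tau>1] W_def by blast
    fix v assume "v \<notin> V - W"
    then consider "v \<in> W" | "v \<notin> V" by blast
    then show "\<sigma>5 v = \<tau>1 v"
    proof cases
      case 1
      then have "v \<in> {v \<in> V. \<sigma>5 v = c}" "v \<in> {v \<in> V. \<tau>1 v = c}"
        using cls5 W_def by simp_all
      then show ?thesis by simp
    next
      case 2
      then show ?thesis
        using recolor_rtranclp_outside[OF \<sigma>5 2] recolor_rtranclp_outside[OF \<tau>1(1) 2] Suc.prems(7)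
        by simp
    qed
  qed
  then have "(recolor H V C)\<^sup>*\<^sup>* \<sigma>5 \<tau>1"
    using recolor_extend_class[OF _ _ cd(1) ind[OF W]] cls5 by blast
  then show ?case
    using \<sigma>5 recolor_rtranclp_sym[OF \<tau>1(1)] by (meson rtranclp_trans)
qed

section \<open>Translation to the coloring graph\<close>

lemma proper_colorings_iff:
  assumes "is_hypergraph H"
  shows "\<sigma> \<in> proper_colorings q H \<longleftrightarrow>
    proper_on H (hverts H) {1..q} \<sigma> \<and> \<sigma> \<in> extensional (hverts H)"
  using assms by (auto simp: proper_colorings_def proper_on_def is_hypergraph_def PiE_def)

lemma recolor_reachable_coloring_graph:
  assumes H: "is_hypergraph H" and "\<sigma> \<in> proper_colorings q H"
    and "(recolor H (hverts H) {1..q})\<^sup>*\<^sup>* \<sigma> \<tau>"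
  shows "\<sigma> \<rightarrow>\<^sup>*\<^bsub>with_proj (coloring_graph q H)\<^esub> \<tau>"
  using assms(3)
proof (induction rule: rtranclp_induct)
  case base
  then show ?case using assms(2) by (auto simp: reachable_def coloring_graph_def)
next
  case (step \<rho> \<tau>)
  have \<rho>: "\<rho> \<in> proper_colorings q H"
    using in_rtrancl_on_in_F(2)[OF step.IH[unfolded reachable_def]] by (simp add: coloring_graph_def)
  from step.hyps(2) obtain v c where v: "v \<in> hverts H" "\<tau> = \<rho>(v := c)"
    by (auto simp: recolor_def)
  have \<tau>: "\<tau> \<in> proper_colorings q H"
    using \<rho> step.hyps(2) v by (auto simp: proper_colorings_iff[OF H] recolor_def extensional_def)
  show ?case
  \<comment> \<open>A \<open>recolor\<close> step may leave the coloring unchanged, whereas an arc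
    joins distinct colorings; such a step is dropped.\<close>
  proof (cases "\<rho> v = c")
    case True
    then have "\<tau> = \<rho>" using v(2) by (metis fun_upd_triv)
    then show ?thesis using step.IH by simp
  next
    case False
    then have "(\<rho>, \<tau>) \<in> parcs (coloring_graph q H)"
      using \<rho> \<tau> v by (auto simp: coloring_graph_def)
    with step.IH \<tau> show ?thesis
      unfolding reachable_def
      by (auto intro: rtrancl_on_into_rtrancl_on simp: coloring_graph_def)
  qed
qed

theorem theorem2:
  fixes H :: "'a hypergraph" and \<alpha> \<beta> q :: nat
  assumes "is_hypergraph H"
    and "ab_colorable \<alpha> \<beta> H"
    and "q \<ge> \<alpha> + \<beta> + 1"
  shows "(\<forall>\<sigma>\<in>proper_colorings q H. \<forall>\<tau>\<in>proper_colorings q H.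
            \<sigma> \<rightarrow>\<^sup>*\<^bsub>with_proj (coloring_graph q H)\<^esub> \<tau>)
       \<and> ((\<forall>e\<in>hedges H. 2 \<le> card e) \<longrightarrow> connected (with_proj (coloring_graph q H)))"
proof -
  let ?V = "hverts H" and ?G = "with_proj (coloring_graph q H)"
  have peel: "peelable H \<beta> \<alpha> ?V" using ab_colorable_peelable assms(1,2) .
  have finV: "finite ?V" using assms(1) by (simp add: is_hypergraph_def)
  have reach: "\<sigma> \<rightarrow>\<^sup>*\<^bsub>?G\<^esub> \<tau>"
    if \<sigma>: "\<sigma> \<in> proper_colorings q H" and \<tau>: "\<tau> \<in> proper_colorings q H" for \<sigma> \<tau>
  proof -
    \<comment> \<open>The proper coloring \<open>\<sigma>\<close> itself rules out edges inside a
      singleton, the side condition of \<open>peelable_connected\<close>.\<close>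
    have "monochromatic \<sigma> e" if "e \<subseteq> {v}" for e v
      using that unfolding monochromatic_def by blast
    then have "\<forall>e\<in>hedges H. \<forall>v. \<not> e \<subseteq> {v}"
      using \<sigma> unfolding proper_colorings_def by blast
    moreover have "\<sigma> v = \<tau> v" if "v \<notin> ?V" for v
      using \<sigma> \<tau> that by (simp add: proper_colorings_iff[OF assms(1)] extensional_def)
    ultimately have "(recolor H ?V {1..q})\<^sup>*\<^sup>* \<sigma> \<tau>"
      using peelable_connected[OF assms(1) _ _ _ finV peel, of "{1..q}" \<sigma> \<tau>] assms(3) \<sigma> \<tau>
      by (auto simp: proper_colorings_iff[OF assms(1)])
    then show ?thesis using recolor_reachable_coloring_graph[OF assms(1) \<sigma>] by blast
  qed
  moreover have "connected ?G" if card2: "\<forall>e\<in>hedges H. 2 \<le> card e"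
  proof -
    interpret pair_wf_digraph "coloring_graph q H"
      by unfold_locales (auto simp: coloring_graph_def)
    have "\<not> e \<subseteq> {v}" if "e \<in> hedges H" for e v
    proof
      assume "e \<subseteq> {v}"
      then have "card e \<le> card {v}" by (intro card_mono) simp_all
      then show False using card2 that by force
    qed
    then obtain \<sigma> where \<sigma>: "proper_on H ?V {1..q} \<sigma>"
      using peelable_ex_proper[OF assms(1) _ _ _ finV peel, of "{1..q}"] assms(3) by auto
    \<comment> \<open>Restriction sets the values outside \<open>?V\<close> to
      \<open>undefined\<close>, as \<open>proper_colorings\<close> demands. The result is the vertex
      that \<open>connected\<close> needs.\<close>
    have "proper_on H ?V {1..q} (restrict \<sigma> ?V)"
      using \<sigma> by (subst proper_on_cong[of _ _ \<sigma>]) auto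
    then have "restrict \<sigma> ?V \<in> proper_colorings q H"
      by (simp add: proper_colorings_iff[OF assms(1)])
    \<comment> \<open>\<open>connected\<close> means strong connectivity of the symmetric closure,
      to which reachability in the graph itself carries over.\<close>
    then show ?thesis
      using reach reachable_mk_symmetricI
      by (auto simp: connected_def strongly_connected_def coloring_graph_def)
  qed
  ultimately show ?thesis by blast
qed

end
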